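(* Let $\triangle ABC$ be an arbitrary triangle in $\mathbb{S}^2$, $\mathbb{E}^2$, or $\mathbb{H}^2$. Let $A_1,A_2$; $B_1,B_2$; and $C_1,C_2$ be points on the oriented side lines $\overleftrightarrow{BC}$, $\overleftrightarrow{AC}$, and $\overleftrightarrow{AB}$ respectively. Then $A_1,A_2,B_1,B_2,C_1,C_2$ lie on a conic if and only if $$\frac{\operatorname{gsin}(AC_1)}{\operatorname{gsin}(C_1B)}\cdot\frac{\operatorname{gsin}(AC_2)}{\operatorname{gsin}(C_2B)}\cdot\frac{\operatorname{gsin}(BA_1)}{\operatorname{gsin}(A_1C)}\cdot\frac{\operatorname{gsin}(BA_2)}{\operatorname{gsin}(A_2C)}\cdot\frac{\operatorname{gsin}(CB_1)}{\operatorname{gsin}(B_1A)}\cdot\frac{\operatorname{gsin}(CB_2)}{\operatorname{gsin}(B_2A)} = 1.$$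
   Context: $\mathbb{E}^2$ is the Euclidean plane (curvature $K=0$). $\mathbb{S}^2$ is the unit sphere $x^2+y^2+z^2=1$ in $\mathbb{R}^3$ with the induced metric ($K=1$). $\mathbb{H}^2$ is the upper sheet $x^2+y^2-z^2=-1$, $z>0$, with the metric induced by $ds^2=dx^2+dy^2-dz^2$ ($K=-1$). A line (geodesic) is an ordinary line in $\mathbb{E}^2$, and the intersection of the surface with a plane through the origin in $\mathbb{S}^2$ or $\mathbb{H}^2$. Two points of $\mathbb{S}^2$ are antipodal if they are the two intersection points of $\mathbb{S}^2$ with a line through the origin. A triangle is given by three non-collinear points (in $\mathbb{S}^2$, no two antipodal, with sides the shorter segments); $\overleftrightarrow{XY}$ is the full line through $X$ and $Y$. The generalized sine is $\operatorname{gsin}(x)=x-\frac{Kx^3}{3!}+\frac{K^2x^5}{5!}-\cdots$, i.e. $\sin x$ in $\mathbb{S}^2$, $x$ in $\mathbb{E}^2$, $\sinh x$ in $\mathbb{H}^2$. For points $X,Y$ on an oriented line, $\operatorname{gsin}(XY)$ is the generalized sine of the signed distance from $X$ to $Y$ along that oriented line (in $\mathbb{S}^2$ both ways of travelling from $X$ to $Y$ give the same value). A conic in $\mathbb{S}^2$ (resp. $\mathbb{H}^2$) is the intersection of $\mathbb{S}^2$ (resp. $\mathbb{H}^2$) with a quadratic cone (a cone whose boundary curve is any conic) with vertex at the origin; in particular a spherical conic contains the antipode of each of its points. In $\mathbb{E}^2$ conics are the usual ones.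
   Formalization: The two points on each side line are assumed distinct (and not antipodal in the sphere), since otherwise a conic always exists whatever the product; all six denominators are assumed nonzero; conics include degenerate ones such as line pairs. *)

theory Defs
  imports "HOL-Analysis.Analysis"
begin

datatype geometry = S2 | E2 | H2

fun curvature :: "geometry \<Rightarrow> real" where
  "curvature S2 = 1"
| "curvature E2 = 0"
| "curvature H2 = - 1"

(* The Euclidean plane is realised as the coordinate plane z = 0, so that all three
   surfaces consist of points of the same type. *)
fun surface :: "geometry \<Rightarrow> (real^3) set" where
  "surface S2 = {x. (x$1)\<^sup>2 + (x$2)\<^sup>2 + (x$3)\<^sup>2 = 1}"
| "surface E2 = {x. x$3 = 0}"
| "surface H2 = {x. (x$1)\<^sup>2 + (x$2)\<^sup>2 - (x$3)\<^sup>2 = - 1 \<and> x$3 > 0}"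

(* The form ds^2 of the ambient space, evaluated at a tangent vector. *)
fun metric_form :: "geometry \<Rightarrow> real^3 \<Rightarrow> real" where
  "metric_form S2 v = (v$1)\<^sup>2 + (v$2)\<^sup>2 + (v$3)\<^sup>2"
| "metric_form E2 v = (v$1)\<^sup>2 + (v$2)\<^sup>2 + (v$3)\<^sup>2"
| "metric_form H2 v = (v$1)\<^sup>2 + (v$2)\<^sup>2 - (v$3)\<^sup>2"

(* Some planes through the origin miss the hyperboloid, hence the nonemptiness condition. *)
definition is_line :: "geometry \<Rightarrow> (real^3) set \<Rightarrow> bool" where
  "is_line G L \<longleftrightarrow>
     (if G = E2 then affine L \<and> aff_dim L = 1 \<and> L \<subseteq> surface E2
      else L \<noteq> {} \<and> (\<exists>P. subspace P \<and> dim P = 2 \<and> L = surface G \<inter> P))"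

definition antipodal :: "geometry \<Rightarrow> real^3 \<Rightarrow> real^3 \<Rightarrow> bool" where
  "antipodal G X Y \<longleftrightarrow> G = S2 \<and> Y = - X"

definition triangle :: "geometry \<Rightarrow> real^3 \<Rightarrow> real^3 \<Rightarrow> real^3 \<Rightarrow> bool" where
  "triangle G A B C \<longleftrightarrow>
     {A, B, C} \<subseteq> surface G \<and>
     \<not> (\<exists>L. is_line G L \<and> {A, B, C} \<subseteq> L) \<and>
     \<not> antipodal G A B \<and> \<not> antipodal G B C \<and> \<not> antipodal G C A"

(* An oriented line is given by an arc-length parametrisation of the whole line, which for
   a great circle runs around infinitely often; the direction of travel is the orientation. *)
definition oriented_line :: "geometry \<Rightarrow> (real \<Rightarrow> real^3) \<Rightarrow> bool" where
  "oriented_line G l \<longleftrightarrow>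
     is_line G (range l) \<and>
     l C1_differentiable_on UNIV \<and>
     (\<forall>t. metric_form G (vector_derivative l (at t)) = 1)"

(* On a great circle the signed distance is determined only up to multiples of 2 pi,
   which does not affect its sine; otherwise it is unique. *)
definition signed_dist :: "(real \<Rightarrow> real^3) \<Rightarrow> real^3 \<Rightarrow> real^3 \<Rightarrow> real" where
  "signed_dist l X Y = (SOME d. \<exists>s. l s = X \<and> l (s + d) = Y)"

definition gsin :: "geometry \<Rightarrow> real \<Rightarrow> real" where
  "gsin G x = (\<Sum>n. (- curvature G) ^ n * x ^ (2 * n + 1) / fact (2 * n + 1))"

lemma gsin_S2: "gsin S2 x = sin x"
  using sums_unique[OF sin_paired[of x]] by (simp add: gsin_def)

lemma gsin_E2: "gsin E2 x = x"
proof -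
  have "(\<lambda>n. (0::real) ^ n * x ^ (2 * n + 1) / fact (2 * n + 1)) sums
      (\<Sum>n\<in>{0}. (0::real) ^ n * x ^ (2 * n + 1) / fact (2 * n + 1))"
    by (rule sums_finite) auto
  from sums_unique[OF this] show ?thesis by (simp add: gsin_def)
qed

lemma gsin_H2: "gsin H2 x = sinh x"
proof -
  have "strict_mono (\<lambda>n::nat. 2 * n + 1)"
    by (simp add: strict_mono_def)
  then have "(\<lambda>n. (if even (2 * n + 1) then 0 else x ^ (2 * n + 1) /\<^sub>R fact (2 * n + 1)))
      sums sinh x"
    using sinh_converges[of x]
    by (subst sums_mono_reindex) (auto elim!: oddE)
  from sums_unique[OF this] show ?thesis by (simp add: gsin_def field_simps)
qed

definition gsin_seg :: "geometry \<Rightarrow> (real \<Rightarrow> real^3) \<Rightarrow> real^3 \<Rightarrow> real^3 \<Rightarrow> real" where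
  "gsin_seg G l X Y = gsin G (signed_dist l X Y)"

(* The curve of degree two, possibly degenerate, with the given equation in the affine
   coordinates s, t of the plane with origin p and axes u, v. *)
definition conic_in_plane :: "real^3 \<Rightarrow> real^3 \<Rightarrow> real^3 \<Rightarrow> (real^3) set \<Rightarrow> bool" where
  "conic_in_plane p u v E \<longleftrightarrow>
     (\<exists>a b c d e f. (a, b, c) \<noteq> (0, 0, 0) \<and>
        E = {p + s *\<^sub>R u + t *\<^sub>R v | s t.
              a * s\<^sup>2 + b * s * t + c * t\<^sup>2 + d * s + e * t + f = 0})"

(* The two-sided cone with vertex 0 over a conic in any plane that misses 0.  The closure adds
   the generators parallel to that plane, e.g. the asymptotic directions of a hyperbola. *)
definition quadratic_cone :: "(real^3) set \<Rightarrow> bool" where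
  "quadratic_cone K \<longleftrightarrow>
     (\<exists>p u v E. dim {p, u, v} = 3 \<and> conic_in_plane p u v E \<and>
        K = closure {r *\<^sub>R x | r x. x \<in> E})"

definition conic :: "geometry \<Rightarrow> (real^3) set \<Rightarrow> bool" where
  "conic G Q \<longleftrightarrow>
     (if G = E2 then conic_in_plane 0 (axis 1 1) (axis 2 1) Q
      else (\<exists>K. quadratic_cone K \<and> Q = surface G \<inter> K))"

end

theory Submission
  imports Defs
begin

unbundle cross3_syntax

text \<open>
  All three geometries become linear algebra in \<open>\<real>\<^sup>3\<close> once the Euclidean plane is moved from
  \<open>z = 0\<close> to \<open>z = 1\<close> (\<open>lift\<close>): a line is then always the trace of a plane through the origin, and
  two things remain to be translated.

  \<^item> Generalized sines. A unit-speed parametrization of a line is \<open>l t = gcos t p + gsin t q\<close> with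
    \<open>p = l 0\<close> and \<open>q = l' 0\<close> (\<open>line_parametrization\<close>). By the addition theorem \<open>gsin (XY)\<close> is
    therefore an alternating bilinear function of \<open>X\<close> and \<open>Y\<close> on the plane of the line
    (\<open>gsin_seg_eq_triple\<close>). If \<open>Z = x X + y Y\<close>, evaluating it at \<open>(X, Z)\<close> and \<open>(Z, Y)\<close> gives
    \<open>gsin (XZ) / gsin (ZY) = y / x\<close> (\<open>point_on_side\<close>), whatever the orientation of the line.

  \<^item> Conics. Finitely many points that do not all lie on a line are on a common conic exactly when
    some nonzero quadratic form on \<open>\<real>\<^sup>3\<close> vanishes at them (\<open>form_of_conic\<close>, \<open>conic_of_form\<close>).

  What is left is Carnot's theorem for quadratic forms (\<open>Carnot_for_forms\<close>), in coordinates with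
  respect to the basis \<open>A, B, C\<close>. On the plane spanned by \<open>A\<close> and \<open>B\<close> a quadratic form is
  \<open>P x\<^sup>2 + U x y + Q y\<^sup>2\<close>, and if it vanishes at two independent vectors \<open>(x1, y1)\<close> and
  \<open>(x2, y2)\<close>, then \<open>P : Q = y1 y2 : x1 x2\<close>. The three sides thus prescribe the three cyclic ratios
  \<open>P / Q\<close>, \<open>Q / R\<close>, \<open>R / P\<close> of the coefficients of the squares, and a nonzero form with these
  ratios exists if and only if their product is 1; the mixed coefficients can then be chosen to fit,
  since each of them belongs to one side only.
\<close>

section \<open>Triple products and bases of three-dimensional space\<close>

abbreviation triple :: "real^3 \<Rightarrow> real^3 \<Rightarrow> real^3 \<Rightarrow> real" where
  "triple x y z \<equiv> x \<bullet> (y \<times> z)"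

lemma vec3_eq_iff: "x = y \<longleftrightarrow> x$1 = y$1 \<and> x$2 = y$2 \<and> x$3 = y$3" for x y :: "real^3"
  by (simp add: vec_eq_iff forall_3)

lemma inner3: "x \<bullet> y = x$1 * y$1 + x$2 * y$2 + x$3 * y$3" for x y :: "real^3"
  by (simp add: inner_vec_def sum_3)

lemma triple_rotate: "triple x y z = triple y z x"
  by (simp add: inner3 cross_components algebra_simps)

lemma Cramer_expansion:
  "triple x y z *\<^sub>R w = triple w y z *\<^sub>R x + triple w z x *\<^sub>R y + triple w x y *\<^sub>R z"
  by (simp add: vec3_eq_iff inner3 cross_components) (simp add: algebra_simps)

text \<open>
  Cramer's rule for the dual basis: \<open>w\<close> is recovered from its inner products with \<open>x, y, z\<close>. It
  shows that a nonzero vector orthogonal to all three forces them to be dependent.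
\<close>

lemma dual_Cramer_expansion:
  "triple x y z *\<^sub>R w = (w \<bullet> x) *\<^sub>R (y \<times> z) + (w \<bullet> y) *\<^sub>R (z \<times> x) + (w \<bullet> z) *\<^sub>R (x \<times> y)"
  by (simp add: vec3_eq_iff inner3 cross_components) (simp add: algebra_simps)

lemma triple_eq_0_iff:
  "triple x y z = 0 \<longleftrightarrow> (\<exists>n. n \<noteq> 0 \<and> n \<bullet> x = 0 \<and> n \<bullet> y = 0 \<and> n \<bullet> z = 0)"
proof
  assume "triple x y z = 0"
  then have "\<not> invertible (vector [x, y, z] :: real^3^3)"
    by (simp add: dot_cross_det invertible_det_nz)
  then obtain n where n: "n \<noteq> 0" "(vector [x, y, z] :: real^3^3) *v n = 0"
    by (metis invertible_left_inverse matrix_left_invertible_ker)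
  then have "n \<bullet> x = 0" "n \<bullet> y = 0" "n \<bullet> z = 0"
    by (simp_all add: vec_eq_iff forall_3 matrix_vector_mult_def inner3 sum_3 mult.commute)
  with n show "\<exists>n. n \<noteq> 0 \<and> n \<bullet> x = 0 \<and> n \<bullet> y = 0 \<and> n \<bullet> z = 0" by blast
next
  assume "\<exists>n. n \<noteq> 0 \<and> n \<bullet> x = 0 \<and> n \<bullet> y = 0 \<and> n \<bullet> z = 0"
  then obtain n where "n \<noteq> 0" "n \<bullet> x = 0" "n \<bullet> y = 0" "n \<bullet> z = 0" by blast
  with dual_Cramer_expansion[of x y z n] show "triple x y z = 0" by simp
qed

lemma dim_3_iff_triple: "dim {x, y, z} = 3 \<longleftrightarrow> triple x y z \<noteq> 0"
proof
  assume d: "dim {x, y, z} = 3"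
  then have "span {x, y, z} = (UNIV :: (real^3) set)"
    by (intro dim_eq_full[THEN iffD1]) (simp only: d, simp)
  moreover have "span {x, y, z} \<subseteq> {v. n \<bullet> v = 0}"
    if "n \<bullet> x = 0" "n \<bullet> y = 0" "n \<bullet> z = 0" for n
    by (rule span_minimal[OF _ subspace_hyperplane]) (simp add: that)
  ultimately have "n \<bullet> n = 0" if "n \<bullet> x = 0" "n \<bullet> y = 0" "n \<bullet> z = 0" for n
    using that by blast
  then show "triple x y z \<noteq> 0"
    unfolding triple_eq_0_iff by auto
next
  assume t: "triple x y z \<noteq> 0"
  have "\<not> dim {x, y, z} < DIM(real^3)"
  proof
    assume "dim {x, y, z} < DIM(real^3)"
    then obtain n where "n \<noteq> 0" "span {x, y, z} \<subseteq> {v. n \<bullet> v = 0}"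
      using lowdim_subset_hyperplane by blast
    then have "n \<noteq> 0 \<and> n \<bullet> x = 0 \<and> n \<bullet> y = 0 \<and> n \<bullet> z = 0"
      using span_base[of _ "{x, y, z}"] by blast
    with t show False using triple_eq_0_iff by blast
  qed
  then show "dim {x, y, z} = 3"
    using dim_subset_UNIV[of "{x, y, z}"] by simp
qed

lemma cross_eq_0_imp_scaled: "x \<times> y = 0 \<Longrightarrow> x \<noteq> 0 \<Longrightarrow> \<exists>c. y = c *\<^sub>R x"
  by (force simp: cross_eq_0 collinear_lemma intro: exI[of _ 0])

text \<open>
  The coordinates of a vector in the plane spanned by \<open>x\<close> and \<open>y\<close> are restrictions of linear
  functionals on the whole space. Hence the coordinates of a differentiable curve are
  differentiable, with the coordinates of its velocity as derivatives.
\<close>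

lemma plane_coordinates:
  assumes "x \<times> y \<noteq> 0"
  obtains a b where "a \<bullet> x = 1" "a \<bullet> y = 0" "b \<bullet> x = 0" "b \<bullet> y = 1"
    "\<And>z. triple z x y = 0 \<Longrightarrow> z = (a \<bullet> z) *\<^sub>R x + (b \<bullet> z) *\<^sub>R y"
proof -
  define N where "N = x \<times> y"
  define D where "D = triple x y N"
  have D: "D \<noteq> 0"
    using assms unfolding D_def N_def by (metis cross_triple inner_commute inner_eq_zero_iff)
  \<comment> \<open>the first two vectors of the basis dual to \<open>x, y, N\<close>\<close>
  define a where "a = (1 / D) *\<^sub>R (y \<times> N)"
  define b where "b = (1 / D) *\<^sub>R (N \<times> x)"
  have "D *\<^sub>R z = triple z y N *\<^sub>R x + triple z N x *\<^sub>R y" if "triple z x y = 0" for z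
    using Cramer_expansion[of x y N z] that by (simp add: D_def)
  then have "z = (1 / D) *\<^sub>R (triple z y N *\<^sub>R x + triple z N x *\<^sub>R y)"
    if "triple z x y = 0" for z
    using D that by (metis divide_self scaleR_one scaleR_scaleR times_divide_eq_left mult_1)
  then have "z = (a \<bullet> z) *\<^sub>R x + (b \<bullet> z) *\<^sub>R y" if "triple z x y = 0" for z
    using that by (simp add: a_def b_def scaleR_add_right inner_commute)
  moreover have "a \<bullet> x = 1" "b \<bullet> y = 1"
    using D triple_rotate[of x y N] triple_rotate[of y N x]
    by (simp_all add: a_def b_def D_def inner_commute)
  moreover have "a \<bullet> y = 0" "b \<bullet> x = 0"
    by (simp_all add: a_def b_def dot_cross_self)
  ultimately show thesis using that by blast
qed

lemma finite_avoid_hyperplanes: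
  assumes "finite M" "0 \<notin> M"
  shows "\<exists>y :: 'a :: euclidean_space. \<forall>m\<in>M. m \<bullet> y \<noteq> 0"
proof -
  have "negligible (\<Union>m\<in>M. {y. m \<bullet> y = 0})"
    by (intro negligible_Union finite_imageI assms(1))
       (use assms(2) in \<open>auto intro!: negligible_hyperplane\<close>)
  then have "(\<Union>m\<in>M. {y. m \<bullet> y = 0}) \<noteq> UNIV"
    by (metis non_negligible_UNIV)
  then show ?thesis by blast
qed

section \<open>Lines and the generalized sine\<close>

text \<open>
  With the Euclidean plane at height 1, its lines, like those of the other two surfaces, are the
  intersections with planes through the origin, and vectors in such a plane are unrestricted.
\<close>

definition lift :: "geometry \<Rightarrow> real^3 \<Rightarrow> real^3" where
  "lift G X = (if G = E2 then X + axis 3 1 else X)"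

fun gcos :: "geometry \<Rightarrow> real \<Rightarrow> real" where
  "gcos S2 t = cos t"
| "gcos E2 t = 1"
| "gcos H2 t = cosh t"

lemma gsin_eq: "gsin S2 = sin" "gsin E2 = (\<lambda>t. t)" "gsin H2 = sinh"
  by (auto simp: gsin_S2 gsin_E2 gsin_H2)

lemma gcos_eq: "gcos S2 = cos" "gcos E2 = (\<lambda>t. 1)" "gcos H2 = cosh"
  by auto

lemma gcos_0: "gcos G 0 = 1" and gsin_0: "gsin G 0 = 0"
  by (cases G; simp add: gsin_eq)+

lemma gcos_derivative: "(gcos G has_real_derivative - curvature G * gsin G t) (at t)"
  by (cases G) (auto simp: gsin_eq gcos_eq simp del: gcos.simps intro!: derivative_eq_intros)

lemma gsin_derivative: "(gsin G has_real_derivative gcos G t) (at t)"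
  by (cases G) (auto simp: gsin_eq intro!: derivative_eq_intros)

lemma gcos_gsin_square: "(gcos G t)\<^sup>2 + curvature G * (gsin G t)\<^sup>2 = 1"
  by (cases G) (auto simp: gsin_eq cosh_square_eq)

lemma gsin_difference: "gsin G d = gcos G s * gsin G (s + d) - gsin G s * gcos G (s + d)"
proof (cases G)
  case S2
  then show ?thesis using sin_diff[of "s + d" s] by (simp add: gsin_eq algebra_simps)
next
  case H2
  then show ?thesis using sinh_diff[of "s + d" s] by (simp add: gsin_eq algebra_simps)
qed (simp add: gsin_eq)

lemma constant_if_derivative_0:
  assumes "\<And>t. (f has_real_derivative 0) (at t)"
  shows "f t = f (0::real)"
  using DERIV_isconst_all assms by blast

text \<open>
  Here \<open>x, y\<close> are coordinates with respect to an initial point \<open>p\<close> and initial velocity \<open>q\<close>,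
  orthogonal for the form of the geometry, so that \<open>surf\<close> and \<open>speed\<close> say that the curve stays on
  the surface and has unit speed. These leave only the direction of travel open: the
  Wronskian \<open>x y' - y x'\<close> has square 1. As the curve is continuously differentiable, the Wronskian
  is constant, so the curve cannot turn back, and it satisfies \<open>x' = - K y\<close>, \<open>y' = x\<close>.
\<close>

lemma unit_speed_coordinates:
  fixes x y x' y' :: "real \<Rightarrow> real"
  assumes dx: "\<And>t. (x has_real_derivative x' t) (at t)"
    and dy: "\<And>t. (y has_real_derivative y' t) (at t)"
    and cont: "continuous_on UNIV x'" "continuous_on UNIV y'"
    and surf: "\<And>t. (x t)\<^sup>2 + curvature G * (y t)\<^sup>2 = 1"
    and speed: "\<And>t. curvature G * (x' t)\<^sup>2 + (y' t)\<^sup>2 = 1"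
    and init: "x 0 = 1" "y 0 = 0" "y' 0 = 1"
  shows "x t = gcos G t \<and> y t = gsin G t"
proof -
  let ?K = "curvature G"
  have tangent: "x t * x' t + ?K * (y t * y' t) = 0" for t
  proof -
    have "((\<lambda>t. (x t)\<^sup>2 + ?K * (y t)\<^sup>2) has_real_derivative
        2 * (x t * x' t) + ?K * (2 * (y t * y' t))) (at t)"
      by (auto intro!: derivative_eq_intros dx dy simp: algebra_simps)
    then have "2 * (x t * x' t) + ?K * (2 * (y t * y' t)) = 0"
      using surf DERIV_const by (metis (no_types, lifting) DERIV_unique ext)
    then show ?thesis by (simp add: algebra_simps)
  qed
  define \<epsilon> where "\<epsilon> t = x t * y' t - y t * x' t" for t
  have sq: "(\<epsilon> t)\<^sup>2 = 1" for t
  proof (cases "G = E2")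
    case True
    then have "(x t)\<^sup>2 = 1" "(y' t)\<^sup>2 = 1" "x t * x' t = 0"
      using surf[of t] speed[of t] tangent[of t] by auto
    then show ?thesis
      by (auto simp: \<epsilon>_def power_mult_distrib)
  next
    case False
    then have "?K * ?K = 1" by (cases G) auto
    then have "(\<epsilon> t)\<^sup>2 = ((x t)\<^sup>2 + ?K * (y t)\<^sup>2) * (?K * (x' t)\<^sup>2 + (y' t)\<^sup>2)
        - ?K * (x t * x' t + ?K * (y t * y' t))\<^sup>2"
      unfolding \<epsilon>_def by algebra
    then show ?thesis using surf speed tangent by simp
  qed
  have "\<epsilon> constant_on UNIV"
  proof (rule continuous_finite_range_constant)
    show "continuous_on UNIV \<epsilon>"
      unfolding \<epsilon>_def
      by (intro continuous_intros cont)
         (auto intro!: continuous_at_imp_continuous_on DERIV_isCont dx dy)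
    show "finite (range \<epsilon>)"
      by (rule finite_subset[of _ "{1, -1}"]) (use sq in \<open>auto simp: power2_eq_1_iff\<close>)
  qed simp
  moreover have "\<epsilon> 0 = 1" by (simp add: \<epsilon>_def init)
  ultimately have \<epsilon>: "x t * y' t - y t * x' t = 1" for t
    unfolding constant_on_def \<epsilon>_def by (metis UNIV_I)
  have x': "x' t = - ?K * y t" for t
    using surf[of t] tangent[of t] \<epsilon>[of t] by algebra
  have y': "y' t = x t" for t
    using surf[of t] tangent[of t] \<epsilon>[of t] by algebra
  \<comment> \<open>rotating back by \<open>t\<close> must give a constant vector\<close>
  have "((\<lambda>t. gcos G t * x t + ?K * (gsin G t * y t)) has_real_derivative 0) (at t)" for t
    by (rule derivative_eq_intros gcos_derivative gsin_derivative dx dy refl)+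
       (simp add: x' y' algebra_simps)
  from constant_if_derivative_0[OF this, of t]
  have u: "gcos G t * x t + ?K * (gsin G t * y t) = 1"
    by (simp add: init gcos_0 gsin_0)
  have "((\<lambda>t. gcos G t * y t - gsin G t * x t) has_real_derivative 0) (at t)" for t
    by (rule derivative_eq_intros gcos_derivative gsin_derivative dx dy refl)+
       (simp add: x' y' algebra_simps)
  from constant_if_derivative_0[OF this, of t]
  have v: "gcos G t * y t - gsin G t * x t = 0"
    by (simp add: init gcos_0 gsin_0)
  show ?thesis
    using u v gcos_gsin_square[of G t] by algebra
qed

text \<open>
  In the Euclidean case the lifted line misses the origin, and joining the origin raises its affine
  dimension from 1 to 2.
\<close>

lemma line_in_plane:
  assumes "is_line G L"
  shows "\<exists>n. n \<noteq> 0 \<and> (\<forall>X\<in>L. n \<bullet> lift G X = 0)"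
proof -
  have "dim (lift G ` L) < DIM(real^3)"
  proof (cases "G = E2")
    case True
    let ?M = "(+) (axis 3 1) ` L"
    have eq: "lift G ` L = ?M"
      using True by (auto simp: lift_def add.commute)
    have "int (dim ?M) \<le> int (dim (insert 0 ?M))"
      by (simp add: dim_subset subset_insertI)
    also have "\<dots> = aff_dim (insert 0 ?M)"
      by (rule aff_dim_zero[symmetric]) (simp add: hull_inc)
    also have "\<dots> \<le> aff_dim ?M + 1"
      by (simp add: aff_dim_insert)
    also have "\<dots> = 2"
      using assms True by (simp add: aff_dim_translation_eq is_line_def)
    finally show ?thesis by (simp add: eq)
  next
    case False
    then obtain P where "dim P = 2" "L \<subseteq> P" "lift G ` L = L"
      using assms by (auto simp: is_line_def lift_def)
    then show ?thesis
      using dim_subset[of L P] by simp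
  qed
  then obtain n where "n \<noteq> 0" "span (lift G ` L) \<subseteq> {x. n \<bullet> x = 0}"
    using lowdim_subset_hyperplane by blast
  moreover have "lift G ` L \<subseteq> span (lift G ` L)" by (rule span_superset)
  ultimately show ?thesis by blast
qed

lemma is_line_subset_surface: "is_line G L \<Longrightarrow> L \<subseteq> surface G"
  by (auto simp: is_line_def split: if_splits)

text \<open>
  The vectors \<open>p = l 0\<close> and \<open>q = l' 0\<close> span the plane of the line. On the sphere and the hyperboloid
  they are orthogonal for the ambient form \<open>B\<close>, with \<open>B p p = K\<close> and \<open>B q q = 1\<close>; in the Euclidean
  plane the third coordinate, which is 1 at \<open>p\<close> and 0 at \<open>q\<close>, shows that the coefficient of \<open>p\<close> is 1.
\<close>

lemma line_parametrization:
  assumes "oriented_line G l"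
  shows "\<exists>p q. p \<times> q \<noteq> 0 \<and> (\<forall>t. lift G (l t) = gcos G t *\<^sub>R p + gsin G t *\<^sub>R q)"
proof -
  let ?K = "curvature G"
  define l' where "l' t = vector_derivative l (at t)" for t
  define z where "z t = lift G (l t)" for t
  have C1: "l differentiable at t" "continuous_on UNIV l'" for t
    using assms unfolding oriented_line_def C1_differentiable_on_eq l'_def by auto
  have dl: "(l has_vector_derivative l' t) (at t)" for t
    using C1(1) vector_derivative_works unfolding l'_def by blast
  have dz: "(z has_vector_derivative l' t) (at t)" for t
    unfolding z_def lift_def by (cases "G = E2") (auto intro!: derivative_eq_intros dl)
  have dinner: "((\<lambda>t. a \<bullet> z t) has_real_derivative a \<bullet> l' t) (at t)" for a t
    unfolding has_real_derivative_iff_has_vector_derivative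
    by (rule bounded_linear.has_vector_derivative[OF bounded_linear_inner_right dz])
  have surf: "l t \<in> surface G" for t
    using assms is_line_subset_surface unfolding oriented_line_def by blast
  have speed: "metric_form G (l' t) = 1" for t
    using assms unfolding oriented_line_def l'_def by blast
  obtain n where n: "n \<noteq> 0" "\<And>t. n \<bullet> z t = 0"
    using line_in_plane assms unfolding oriented_line_def z_def by blast
  have n': "n \<bullet> l' t = 0" for t
    using dinner[of n t] n(2) by (metis (no_types, lifting) DERIV_const DERIV_unique ext)
  define p q where "p = z 0" and "q = l' 0"
  have E2: "p$3 = 1 \<and> q$3 = 0 \<and> (q$1)\<^sup>2 + (q$2)\<^sup>2 = 1 \<and> z t $ 3 = 1 \<and> l' t $ 3 = 0"
    if "G = E2" for t
  proof -
    have "z t $ 3 = 1" for t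
      using surf[of t] that by (simp add: z_def lift_def axis_def)
    moreover from this dinner[of "axis 3 1"] have "l' t $ 3 = 0" for t
      by (simp add: inner_axis' ) (metis (no_types, lifting) DERIV_const DERIV_unique ext)
    ultimately show ?thesis
      using speed[of 0] that by (simp add: p_def q_def)
  qed
  define \<sigma> where "\<sigma> = (if G = H2 then -1 else 1 :: real)"
  define B where "B u v = u$1 * v$1 + u$2 * v$2 + \<sigma> * (u$3 * v$3)" for u v :: "real^3"
  have BB: "metric_form G u = B u u" for u
    by (cases G) (auto simp: B_def \<sigma>_def power2_eq_square)
  have Bz: "B (z t) (z t) = ?K" if "G \<noteq> E2" for t
    using surf[of t] that by (cases G) (auto simp: B_def \<sigma>_def z_def lift_def power2_eq_square)
  have dB: "B (z t) (l' t) = 0" if "G \<noteq> E2" for t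
  proof -
    have "((\<lambda>t. z t $ i) has_real_derivative l' t $ i) (at t)" for i
      using dinner[of "axis i 1"] by (simp add: inner_axis')
    then have "((\<lambda>t. B (z t) (z t)) has_real_derivative 2 * B (z t) (l' t)) (at t)"
      unfolding B_def by (auto intro!: derivative_eq_intros simp: algebra_simps)
    then show ?thesis
      using Bz[OF that] by (metis (no_types, lifting) DERIV_const DERIV_unique ext mult_eq_0_iff zero_neq_numeral)
  qed
  have pq: "p \<times> q \<noteq> 0"
  proof
    assume "p \<times> q = 0"
    moreover have "p \<noteq> 0"
      using E2 Bz[of 0] by (cases G) (auto simp: p_def B_def)
    ultimately obtain c where c: "q = c *\<^sub>R p"
      using cross_eq_0_imp_scaled by blast
    show False
    proof (cases "G = E2")
      case True
      with E2[OF True, of 0] c show False by auto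
    next
      case False
      have "B p (c *\<^sub>R p) = c * B p p"
        by (simp add: B_def algebra_simps)
      with dB[OF False, of 0] have "c * B p p = 0"
        by (simp add: c flip: p_def q_def)
      with Bz[OF False, of 0] have "c = 0"
        using False by (cases G) (auto simp: p_def)
      with speed[of 0] show False
        by (simp add: BB c flip: q_def) (simp add: B_def)
    qed
  qed
  obtain a b where ab: "a \<bullet> p = 1" "a \<bullet> q = 0" "b \<bullet> p = 0" "b \<bullet> q = 1"
    and expand: "\<And>v. triple v p q = 0 \<Longrightarrow> v = (a \<bullet> v) *\<^sub>R p + (b \<bullet> v) *\<^sub>R q"
    using plane_coordinates[OF pq] by metis
  have expand: "v = (a \<bullet> v) *\<^sub>R p + (b \<bullet> v) *\<^sub>R q" if "n \<bullet> v = 0" for v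
    using that n n' by (intro expand) (auto simp: triple_eq_0_iff p_def q_def)
  define x y x' y' where "x t = a \<bullet> z t" and "y t = b \<bullet> z t"
    and "x' t = a \<bullet> l' t" and "y' t = b \<bullet> l' t" for t
  note defs = x_def y_def x'_def y'_def
  have z: "z t = x t *\<^sub>R p + y t *\<^sub>R q" and l': "l' t = x' t *\<^sub>R p + y' t *\<^sub>R q" for t
    unfolding defs using expand n n' by blast+
  have B: "B (s *\<^sub>R p + t *\<^sub>R q) (s *\<^sub>R p + t *\<^sub>R q) = ?K * s\<^sup>2 + t\<^sup>2" if "G \<noteq> E2" for s t
  proof -
    have "B p p = ?K" "B p q = 0" "B q q = 1"
      using Bz[OF that, of 0] dB[OF that, of 0] speed[of 0] by (simp_all add: p_def q_def BB)
    moreover have "B (s *\<^sub>R p + t *\<^sub>R q) (s *\<^sub>R p + t *\<^sub>R q) = s\<^sup>2 * B p p + 2 * s * t * B p q + t\<^sup>2 * B q q"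
      by (simp add: B_def algebra_simps power2_eq_square)
    ultimately show ?thesis by simp
  qed
  have "x t = gcos G t \<and> y t = gsin G t" for t
  proof (rule unit_speed_coordinates[of x x' y y'])
    fix t
    show "(x has_real_derivative x' t) (at t)" "(y has_real_derivative y' t) (at t)"
      unfolding defs using dinner by blast+
    show "(x t)\<^sup>2 + ?K * (y t)\<^sup>2 = 1"
    proof (cases "G = E2")
      case True
      with E2[of t] z[of t] show ?thesis by auto
    next
      case False
      with Bz[OF False, of t] B[OF False, of "x t" "y t"] show ?thesis
        by (cases G) (auto simp: z)
    qed
    show "?K * (x' t)\<^sup>2 + (y' t)\<^sup>2 = 1"
    proof (cases "G = E2")
      case True
      with E2[of t] l'[of t] have "x' t = 0" by auto
      with l'[of t] have "l' t = y' t *\<^sub>R q" by simp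
      with speed[of t] True have "(y' t * q$1)\<^sup>2 + (y' t * q$2)\<^sup>2 + (y' t * q$3)\<^sup>2 = 1"
        by simp
      moreover have "q$3 = 0" using E2[OF True] by blast
      ultimately have "(y' t)\<^sup>2 * ((q$1)\<^sup>2 + (q$2)\<^sup>2) = 1"
        by (simp add: power_mult_distrib distrib_left)
      moreover have "(q$1)\<^sup>2 + (q$2)\<^sup>2 = 1" using E2[OF True] by blast
      ultimately have "(y' t)\<^sup>2 = 1" by (metis mult_1_right)
      then show ?thesis using True by simp
    next
      case False
      with speed[of t] B[OF False, of "x' t" "y' t"] show ?thesis
        by (simp add: BB l')
    qed
  next
    show "continuous_on UNIV x'" "continuous_on UNIV y'"
      unfolding defs by (intro continuous_intros C1)+
    show "x 0 = 1" "y 0 = 0" "y' 0 = 1"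
      using ab by (simp_all add: defs flip: p_def q_def)
  qed
  with pq z show ?thesis unfolding z_def by metis
qed

text \<open>
  The vector \<open>m\<close> is normal to the plane of the line, with length and sign adjusted so that the
  oriented area of the parallelogram on \<open>l s\<close> and \<open>l (s + d)\<close> is \<open>gsin d\<close>.
\<close>

lemma gsin_seg_eq_triple:
  assumes "oriented_line G l"
  shows "\<exists>m n. n \<noteq> 0 \<and> (\<forall>X\<in>range l. n \<bullet> lift G X = 0) \<and>
    (\<forall>X\<in>range l. \<forall>Y\<in>range l. gsin_seg G l X Y = triple m (lift G X) (lift G Y))"
proof -
  obtain p q where pq: "p \<times> q \<noteq> 0"
    and l: "\<And>t. lift G (l t) = gcos G t *\<^sub>R p + gsin G t *\<^sub>R q"
    using line_parametrization[OF assms] by blast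
  define n where "n = p \<times> q"
  define m where "m = (1 / (n \<bullet> n)) *\<^sub>R n"
  have "n \<bullet> lift G X = 0" if "X \<in> range l" for X
    using that by (auto simp: l n_def inner_add_right dot_cross_self inner_commute)
  moreover have "gsin_seg G l X Y = triple m (lift G X) (lift G Y)"
    if X: "X \<in> range l" and Y: "Y \<in> range l" for X Y
  proof -
    \<comment> \<open>any \<open>d\<close> leading from \<open>X\<close> to \<open>Y\<close> gives the same value, so the choice made on a great circle
      is immaterial\<close>
    define d where "d = signed_dist l X Y"
    have "\<exists>d s. l s = X \<and> l (s + d) = Y"
      using X Y by (metis add.commute diff_add_cancel imageE)
    then have "\<exists>s. l s = X \<and> l (s + d) = Y"
      unfolding d_def signed_dist_def by (rule someI_ex)
    then obtain s where s: "l s = X" "l (s + d) = Y" by blast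
    have "lift G X \<times> lift G Y
        = (gcos G s * gsin G (s + d) - gsin G s * gcos G (s + d)) *\<^sub>R n"
      unfolding s[symmetric] l n_def
      by (simp add: cross_add_left cross_add_right cross_mult_left cross_mult_right
          cross_skew[of q p] scaleR_diff_left mult.commute)
    then show ?thesis
      using pq unfolding gsin_difference[symmetric] gsin_seg_def d_def[symmetric] m_def
      by (simp add: n_def)
  qed
  ultimately show ?thesis using pq n_def by blast
qed

section \<open>Conics and quadratic forms\<close>

text \<open>
  Defining forms by a bilinear map, not by a list of coefficients, avoids all changes of basis: the
  coefficients in any basis are read off by \<open>quadratic_form_combination\<close>.
\<close>

definition quadratic_form :: "(real^3 \<Rightarrow> real) \<Rightarrow> bool" where
  "quadratic_form F \<longleftrightarrow> (\<exists>\<beta>. bilinear \<beta> \<and> F = (\<lambda>x. \<beta> x x))"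

lemma quadratic_form_combination:
  assumes "quadratic_form F"
  shows "\<exists>a b c d e f. \<forall>r s t. F (r *\<^sub>R x + s *\<^sub>R y + t *\<^sub>R z) =
    a * s\<^sup>2 + b * (s * t) + c * t\<^sup>2 + d * (r * s) + e * (r * t) + f * r\<^sup>2"
proof -
  obtain \<beta> where \<beta>: "bilinear \<beta>" and F: "F = (\<lambda>x. \<beta> x x)"
    using assms quadratic_form_def by blast
  have "F (r *\<^sub>R x + s *\<^sub>R y + t *\<^sub>R z) = \<beta> y y * s\<^sup>2 + (\<beta> y z + \<beta> z y) * (s * t) + \<beta> z z * t\<^sup>2
      + (\<beta> x y + \<beta> y x) * (r * s) + (\<beta> x z + \<beta> z x) * (r * t) + \<beta> x x * r\<^sup>2" for r s t
    unfolding F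
    by (simp add: bilinear_ladd[OF \<beta>] bilinear_radd[OF \<beta>] bilinear_lmul[OF \<beta>] bilinear_rmul[OF \<beta>]
        algebra_simps power2_eq_square)
  then show ?thesis by blast
qed

lemma quadratic_form_scale:
  assumes "quadratic_form F"
  shows "F (r *\<^sub>R x) = r\<^sup>2 * F x"
  using assms unfolding quadratic_form_def
  by (auto simp: bilinear_lmul bilinear_rmul power2_eq_square)

lemma quadratic_form_continuous:
  assumes "quadratic_form F"
  shows "continuous_on UNIV F"
proof -
  obtain \<beta> where "bilinear \<beta>" and F: "F = (\<lambda>x. \<beta> x x)"
    using assms quadratic_form_def by blast
  then have "bounded_bilinear \<beta>"
    by (simp add: bilinear_conv_bounded_bilinear)
  from bounded_bilinear.continuous_on[OF this continuous_on_id continuous_on_id]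
  show ?thesis unfolding F .
qed

lemma quadratic_form_of_coefficients:
  assumes "triple x y z \<noteq> 0"
  shows "\<exists>F. quadratic_form F \<and> (\<forall>r s t. F (r *\<^sub>R x + s *\<^sub>R y + t *\<^sub>R z) =
    a * s\<^sup>2 + b * (s * t) + c * t\<^sup>2 + d * (r * s) + e * (r * t) + f * r\<^sup>2)"
proof -
  let ?D = "triple x y z"
  define X Y Z where "X w = (w \<bullet> (y \<times> z)) / ?D" and "Y w = (w \<bullet> (z \<times> x)) / ?D"
    and "Z w = (w \<bullet> (x \<times> y)) / ?D" for w
  define \<beta> where "\<beta> v w = a * (Y v * Y w) + b * (Y v * Z w) + c * (Z v * Z w)
    + d * (X v * Y w) + e * (X v * Z w) + f * (X v * X w)" for v w
  have "bilinear \<beta>"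
    unfolding bilinear_def \<beta>_def X_def Y_def Z_def
    by (auto intro!: linearI simp: inner_add_left algebra_simps add_divide_distrib)
  moreover have "X (r *\<^sub>R x + s *\<^sub>R y + t *\<^sub>R z) = r" "Y (r *\<^sub>R x + s *\<^sub>R y + t *\<^sub>R z) = s"
    "Z (r *\<^sub>R x + s *\<^sub>R y + t *\<^sub>R z) = t" for r s t
    using assms triple_rotate[of x y z] triple_rotate[of y z x]
    by (simp_all add: X_def Y_def Z_def inner_add_left dot_cross_self)
  ultimately show ?thesis
    unfolding quadratic_form_def
    by (intro exI[of _ "\<lambda>v. \<beta> v v"] conjI) (auto simp: \<beta>_def power2_eq_square algebra_simps)
qed

lemma basis_expansion:
  assumes "triple x y z \<noteq> 0"
  shows "\<exists>r s t. w = r *\<^sub>R x + s *\<^sub>R y + t *\<^sub>R z"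
proof -
  let ?D = "triple x y z"
  have "w = (1 / ?D) *\<^sub>R (?D *\<^sub>R w)" using assms by simp
  also have "\<dots> = (triple w y z / ?D) *\<^sub>R x + (triple w z x / ?D) *\<^sub>R y + (triple w x y / ?D) *\<^sub>R z"
    unfolding Cramer_expansion[of x y z w] by (simp add: scaleR_add_right)
  finally show ?thesis by blast
qed

text \<open>
  Homogenization of the equation of \<open>E\<close>. The plane is shifted from \<open>p\<close> to \<open>p'\<close> so that the lemma
  also covers the Euclidean plane, which contains the origin before it is lifted.
\<close>

lemma form_of_conic_in_plane:
  assumes "conic_in_plane p u v E" "triple p' u v \<noteq> 0"
  shows "\<exists>F. quadratic_form F \<and> (\<exists>x. F x \<noteq> 0) \<and> (\<forall>x\<in>E. F (x - p + p') = 0)"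
proof -
  obtain a b c d e f where nz: "(a, b, c) \<noteq> (0, 0, 0)"
    and E: "E = {p + s *\<^sub>R u + t *\<^sub>R v | s t.
      a * s\<^sup>2 + b * s * t + c * t\<^sup>2 + d * s + e * t + f = 0}"
    using assms(1) unfolding conic_in_plane_def by blast
  obtain F where F: "quadratic_form F"
    and coeff: "\<And>r s t. F (r *\<^sub>R p' + s *\<^sub>R u + t *\<^sub>R v) =
      a * s\<^sup>2 + b * (s * t) + c * t\<^sup>2 + d * (r * s) + e * (r * t) + f * r\<^sup>2"
    using quadratic_form_of_coefficients[OF assms(2)] by blast
  have "\<exists>x. F x \<noteq> 0"
  proof (rule ccontr)
    assume "\<not> (\<exists>x. F x \<noteq> 0)"
    then have "a = 0" "c = 0" "a + b + c = 0"
      using coeff[of 0 1 0] coeff[of 0 0 1] coeff[of 0 1 1] by simp_all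
    with nz show False by simp
  qed
  moreover have "F (x - p + p') = 0" if xE: "x \<in> E" for x
  proof -
    obtain s t where x: "x = p + s *\<^sub>R u + t *\<^sub>R v"
      and 0: "a * s\<^sup>2 + b * s * t + c * t\<^sup>2 + d * s + e * t + f = 0"
      using xE E by blast
    have "x - p + p' = 1 *\<^sub>R p' + s *\<^sub>R u + t *\<^sub>R v" by (simp add: x)
    then show ?thesis using 0 coeff[of 1 s t] by (simp only:) simp
  qed
  ultimately show ?thesis using F by blast
qed

text \<open>
  The condition on \<open>F\<close> makes the dehomogenized equation one of degree two: its
  leading part is \<open>F\<close> on the directions of the plane.
\<close>

lemma conic_in_plane_of_form:
  assumes "quadratic_form F" "F (s0 *\<^sub>R u + t0 *\<^sub>R v) \<noteq> 0"
  shows "conic_in_plane p u v {p + s *\<^sub>R u + t *\<^sub>R v | s t. F (p' + s *\<^sub>R u + t *\<^sub>R v) = 0}"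
proof -
  obtain a b c d e f where coeff: "\<And>r s t. F (r *\<^sub>R p' + s *\<^sub>R u + t *\<^sub>R v) =
      a * s\<^sup>2 + b * (s * t) + c * t\<^sup>2 + d * (r * s) + e * (r * t) + f * r\<^sup>2"
    using quadratic_form_combination[OF assms(1), of p' u v] by blast
  have nz: "(a, b, c) \<noteq> (0, 0, 0)"
    using coeff[of 0 s0 t0] assms(2) by auto
  have poly: "F (p' + s *\<^sub>R u + t *\<^sub>R v)
      = a * s\<^sup>2 + b * s * t + c * t\<^sup>2 + d * s + e * t + f" for s t
    using coeff[of 1 s t] by (simp add: mult.assoc)
  have eq: "{p + s *\<^sub>R u + t *\<^sub>R v | s t. F (p' + s *\<^sub>R u + t *\<^sub>R v) = 0} =
      {p + s *\<^sub>R u + t *\<^sub>R v | s t. a * s\<^sup>2 + b * s * t + c * t\<^sup>2 + d * s + e * t + f = 0}"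
    by (simp only: poly)
  show ?thesis
    unfolding conic_in_plane_def by (rule exI)+ (rule conjI[OF nz eq])
qed

text \<open>
  The closure in the definition of a cone adds nothing outside the zero set of the form, which is
  closed.
\<close>

lemma form_of_conic:
  assumes "conic G Q"
  shows "\<exists>F. quadratic_form F \<and> (\<exists>x. F x \<noteq> 0) \<and> (\<forall>X\<in>Q. F (lift G X) = 0)"
proof (cases "G = E2")
  case True
  have "triple (axis 3 1) (axis 1 1) (axis 2 1) \<noteq> 0"
    by (simp add: cross_basis inner_axis_axis)
  from form_of_conic_in_plane[OF _ this, of 0 Q] assms True show ?thesis
    by (simp add: conic_def lift_def)
next
  case False
  then obtain p u v E where "dim {p, u, v} = 3" "conic_in_plane p u v E"
    and Q: "Q = surface G \<inter> closure {r *\<^sub>R x | r x. x \<in> E}"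
    using assms unfolding conic_def quadratic_cone_def by auto
  then have "\<exists>F. quadratic_form F \<and> (\<exists>x. F x \<noteq> 0) \<and> (\<forall>x\<in>E. F (x - p + p) = 0)"
    by (intro form_of_conic_in_plane) (simp_all only: dim_3_iff_triple)
  then obtain F where F: "quadratic_form F" "\<exists>x. F x \<noteq> 0" and E: "\<And>x. x \<in> E \<Longrightarrow> F x = 0"
    by auto
  have "closure {r *\<^sub>R x | r x. x \<in> E} \<subseteq> {x. F x = 0}"
  proof (rule closure_minimal)
    show "{r *\<^sub>R x | r x. x \<in> E} \<subseteq> {x. F x = 0}"
      using E quadratic_form_scale[OF F(1)] by auto
    show "closed {x. F x = 0}"
      using quadratic_form_continuous[OF F(1)] by (intro closed_Collect_eq continuous_intros)
  qed
  with F Q False show ?thesis by (auto simp: lift_def)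
qed

lemma lift_nonzero: "X \<in> surface G \<Longrightarrow> lift G X \<noteq> 0"
  by (cases G) (auto simp: lift_def vec3_eq_iff axis_def)

text \<open>
  In the Euclidean plane the only obstacle is a form \<open>F\<close> that vanishes at all points at infinity;
  such a form is \<open>z\<close> times a linear form, and then all points of \<open>S\<close> are on one line.
  
  For the other two surfaces a plane has to be found in which the cone \<open>F = 0\<close> is cut in a curve of
  degree two and which meets the generators through all points of \<open>S\<close>. Its normal \<open>w\<close> is chosen
  orthogonal to a vector \<open>x0\<close> with \<open>F x0 \<noteq> 0\<close>, which ensures the degree, but to no point of \<open>S\<close>;
  this is possible because no point of \<open>S\<close> is a multiple of \<open>x0\<close>.
\<close>

lemma conic_of_form:
  assumes F: "quadratic_form F" "F x0 \<noteq> 0"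
    and S: "finite S" "S \<subseteq> surface G" "\<And>X. X \<in> S \<Longrightarrow> F (lift G X) = 0"
    and spread: "\<And>n. (\<And>X. X \<in> S \<Longrightarrow> n \<bullet> lift G X = 0) \<Longrightarrow> n = 0"
  shows "\<exists>Q. conic G Q \<and> S \<subseteq> Q"
proof (cases "G = E2")
  case True
  let ?e1 = "axis 1 1 :: real^3" and ?e2 = "axis 2 1 :: real^3" and ?e3 = "axis 3 1 :: real^3"
  have expand: "X = 0 + X$1 *\<^sub>R ?e1 + X$2 *\<^sub>R ?e2"
    and lift: "lift G X = ?e3 + X$1 *\<^sub>R ?e1 + X$2 *\<^sub>R ?e2" if "X \<in> S" for X
    using that S(2) True by (auto simp: lift_def vec3_eq_iff axis_def)
  have "\<exists>s t. F (s *\<^sub>R ?e1 + t *\<^sub>R ?e2) \<noteq> 0"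
  proof (rule ccontr)
    assume *: "\<not> (\<exists>s t. F (s *\<^sub>R ?e1 + t *\<^sub>R ?e2) \<noteq> 0)"
    obtain a b c d e f where coeff: "\<And>r s t. F (r *\<^sub>R ?e3 + s *\<^sub>R ?e1 + t *\<^sub>R ?e2) =
        a * s\<^sup>2 + b * (s * t) + c * t\<^sup>2 + d * (r * s) + e * (r * t) + f * r\<^sup>2"
      using quadratic_form_combination[OF F(1), of ?e3 ?e1 ?e2] by blast
    have "a * s\<^sup>2 + b * (s * t) + c * t\<^sup>2 = 0" for s t
      using coeff[of 0 s t] * by simp
    with coeff have line: "F (r *\<^sub>R ?e3 + s *\<^sub>R ?e1 + t *\<^sub>R ?e2) = r * (d * s + e * t + f * r)"
      for r s t by (simp add: algebra_simps power2_eq_square)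
    have "d *\<^sub>R ?e1 + e *\<^sub>R ?e2 + f *\<^sub>R ?e3 = 0"
    proof (rule spread)
      fix X assume "X \<in> S"
      with S(3)[OF this] line[of 1 "X$1" "X$2"] lift[OF this]
      show "(d *\<^sub>R ?e1 + e *\<^sub>R ?e2 + f *\<^sub>R ?e3) \<bullet> lift G X = 0"
        by (simp add: inner3 axis_def)
    qed
    then have "d = 0" "e = 0" "f = 0" by (auto simp: vec3_eq_iff axis_def)
    moreover have "x0 = (x0$3) *\<^sub>R ?e3 + (x0$1) *\<^sub>R ?e1 + (x0$2) *\<^sub>R ?e2"
      by (simp add: vec3_eq_iff axis_def)
    ultimately have "F x0 = 0" using line[of "x0$3" "x0$1" "x0$2"] by simp
    with F(2) show False ..
  qed
  then obtain s0 t0 where "F (s0 *\<^sub>R ?e1 + t0 *\<^sub>R ?e2) \<noteq> 0" by blast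
  from conic_in_plane_of_form[OF F(1) this, of 0 ?e3]
  have "conic G {0 + s *\<^sub>R ?e1 + t *\<^sub>R ?e2 | s t. F (?e3 + s *\<^sub>R ?e1 + t *\<^sub>R ?e2) = 0}"
    using True by (simp add: conic_def)
  moreover have "S \<subseteq> {0 + s *\<^sub>R ?e1 + t *\<^sub>R ?e2 | s t. F (?e3 + s *\<^sub>R ?e1 + t *\<^sub>R ?e2) = 0}"
  proof
    fix X assume X: "X \<in> S"
    have "F (?e3 + X$1 *\<^sub>R ?e1 + X$2 *\<^sub>R ?e2) = 0"
      using S(3)[OF X] lift[OF X] by simp
    with expand[OF X] show "X \<in> {0 + s *\<^sub>R ?e1 + t *\<^sub>R ?e2 | s t. F (?e3 + s *\<^sub>R ?e1 + t *\<^sub>R ?e2) = 0}"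
      by blast
  qed
  ultimately show ?thesis by blast
next
  case False
  have FS: "F X = 0" and S0: "X \<noteq> 0" if "X \<in> S" for X
    using S(3)[OF that] lift_nonzero[of X G] S(2) that False by (auto simp: lift_def)
  have "x0 \<noteq> 0"
    using quadratic_form_scale[OF F(1), of 0 0] F(2) by auto
  have "X \<times> x0 \<noteq> 0" if "X \<in> S" for X
    using cross_eq_0_imp_scaled[of X x0] S0[OF that] FS[OF that] F(2)
      quadratic_form_scale[OF F(1), of _ X] by fastforce
  then have "0 \<notin> (\<lambda>X. X \<times> x0) ` S" by force
  then obtain y where y: "\<And>X. X \<in> S \<Longrightarrow> (X \<times> x0) \<bullet> y \<noteq> 0"
    using finite_avoid_hyperplanes[of "(\<lambda>X. X \<times> x0) ` S"] S(1) by blast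
  define w where "w = x0 \<times> y"
  have w: "w \<bullet> x0 = 0" "\<And>X. X \<in> S \<Longrightarrow> w \<bullet> X \<noteq> 0"
    using y by (auto simp: w_def dot_cross_self inner_commute) (metis cross_triple inner_commute)
  have "S \<noteq> {}"
    using spread[of x0] \<open>x0 \<noteq> 0\<close> by blast
  then have "w \<noteq> 0" using w(2) by auto
  define v where "v = w \<times> x0"
  have "(norm v)\<^sup>2 = (norm w)\<^sup>2 * (norm x0)\<^sup>2"
    by (simp add: v_def norm_cross w(1))
  then have "v \<noteq> 0" using \<open>w \<noteq> 0\<close> \<open>x0 \<noteq> 0\<close> by auto
  then have triple: "triple w x0 v \<noteq> 0"
    by (metis cross_triple inner_commute inner_eq_zero_iff v_def)
  define E where "E = {w + s *\<^sub>R x0 + t *\<^sub>R v | s t. F (w + s *\<^sub>R x0 + t *\<^sub>R v) = 0}"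
  have "conic_in_plane w x0 v E"
    unfolding E_def using F by (intro conic_in_plane_of_form[of F 1 _ 0]) auto
  then have "quadratic_cone (closure {r *\<^sub>R x | r x. x \<in> E})"
    unfolding quadratic_cone_def using triple dim_3_iff_triple by blast
  then have "conic G (surface G \<inter> closure {r *\<^sub>R x | r x. x \<in> E})"
    using False by (auto simp: conic_def)
  moreover have "X \<in> closure {r *\<^sub>R x | r x. x \<in> E}" if X: "X \<in> S" for X
  proof -
    obtain r s t where rst: "X = r *\<^sub>R w + s *\<^sub>R x0 + t *\<^sub>R v"
      using basis_expansion[OF triple] by blast
    then have "w \<bullet> X = r * (w \<bullet> w)"
      by (simp add: inner_add_right w(1) v_def dot_cross_self)
    with w(2)[OF X] have "r \<noteq> 0" by auto
    define x where "x = w + (s / r) *\<^sub>R x0 + (t / r) *\<^sub>R v"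
    have Xx: "X = r *\<^sub>R x"
      using \<open>r \<noteq> 0\<close> by (simp add: rst x_def scaleR_add_right)
    with FS[OF X] \<open>r \<noteq> 0\<close> have "F x = 0"
      by (simp add: quadratic_form_scale[OF F(1)])
    then have "x \<in> E" unfolding E_def x_def by blast
    with Xx have "X \<in> {r *\<^sub>R x | r x. x \<in> E}" by blast
    then show ?thesis by (rule subsetD[OF closure_subset])
  qed
  ultimately show ?thesis using S(2) by blast
qed

section \<open>Carnot's theorem\<close>

lemma lift_cross_nonzero:
  assumes "X \<in> surface G" "Y \<in> surface G" "X \<noteq> Y" "\<not> antipodal G X Y"
  shows "lift G X \<times> lift G Y \<noteq> 0"
proof
  assume "lift G X \<times> lift G Y = 0"
  then obtain c where c: "lift G Y = c *\<^sub>R lift G X"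
    using cross_eq_0_imp_scaled lift_nonzero[OF assms(1)] by blast
  have "c = 1 \<or> G = S2 \<and> c = - 1"
  proof (cases G)
    case S2
    have "c\<^sup>2 * ((X$1)\<^sup>2 + (X$2)\<^sup>2 + (X$3)\<^sup>2) = (Y$1)\<^sup>2 + (Y$2)\<^sup>2 + (Y$3)\<^sup>2"
      using c S2 by (simp add: lift_def power_mult_distrib distrib_left)
    with assms(1,2) S2 show ?thesis by (simp add: power2_eq_1_iff)
  next
    case E2
    have "lift G X $ 3 = 1" "lift G Y $ 3 = 1"
      using assms(1,2) E2 by (simp_all add: lift_def axis_def)
    with c show ?thesis by simp
  next
    case H2
    have "c\<^sup>2 * ((X$1)\<^sup>2 + (X$2)\<^sup>2 - (X$3)\<^sup>2) = (Y$1)\<^sup>2 + (Y$2)\<^sup>2 - (Y$3)\<^sup>2"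
      using c H2 by (simp add: lift_def power_mult_distrib distrib_left right_diff_distrib)
    with assms(1,2) H2 have "c = 1 \<or> c = - 1" by (simp add: power2_eq_1_iff)
    moreover have "c \<noteq> - 1"
    proof
      assume "c = - 1"
      then have "Y$3 = - X$3" using c H2 by (simp add: lift_def)
      with assms(1,2) H2 show False by simp
    qed
    ultimately show ?thesis by simp
  qed
  with c assms(3,4) show False
    by (auto simp: antipodal_def lift_def split: if_splits)
qed

text \<open>
  A vector \<open>n\<close> orthogonal to the three lifted vertices defines a line that contains them. In the
  Euclidean case the line has the equation \<open>n1 x + n2 y + n3 = 0\<close> and the direction
  \<open>v = (- n2, n1)\<close>.
\<close>

lemma triangle_triple_nonzero:
  assumes "triangle G A B C"
  shows "triple (lift G A) (lift G B) (lift G C) \<noteq> 0"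
proof
  assume "triple (lift G A) (lift G B) (lift G C) = 0"
  then obtain n where n: "n \<noteq> 0" "\<And>X. X \<in> {A, B, C} \<Longrightarrow> n \<bullet> lift G X = 0"
    unfolding triple_eq_0_iff by auto
  have surf: "\<And>X. X \<in> {A, B, C} \<Longrightarrow> X \<in> surface G"
    using assms unfolding triangle_def by blast
  have "\<exists>L. is_line G L \<and> {A, B, C} \<subseteq> L"
  proof (cases "G = E2")
    case True
    define v :: "real^3" where "v = vector [- n$2, n$1, 0]"
    define w where "w = (n$1)\<^sup>2 + (n$2)\<^sup>2"
    have v: "v$1 = - n$2" "v$2 = n$1" "v$3 = 0" by (simp_all add: v_def)
    have E2: "X$3 = 0" "n$1 * X$1 + n$2 * X$2 + n$3 = 0" if "X \<in> {A, B, C}" for X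
      using surf[OF that] n(2)[OF that] True
      by (simp_all add: lift_def inner3 axis_def)
    have w: "w \<noteq> 0"
    proof
      assume "w = 0"
      then have "n$1 = 0" "n$2 = 0" by (simp_all add: w_def sum_power2_eq_zero_iff)
      with E2(2)[of A] n(1) show False by (simp add: vec3_eq_iff)
    qed
    let ?L = "affine hull {A, A + v}"
    have "v \<noteq> 0" using w by (auto simp: w_def vec3_eq_iff v)
    have "?L \<subseteq> surface E2"
      using E2(1)[of A] by (auto simp: affine_hull_2 v)
    moreover have "aff_dim ?L = 1" using \<open>v \<noteq> 0\<close> by simp
    ultimately have "is_line G ?L"
      using True by (simp add: is_line_def affine_affine_hull)
    moreover have "X \<in> ?L" if X: "X \<in> {A, B, C}" for X
    proof -
      define r where "r = (n$1 * (X$2 - A$2) - n$2 * (X$1 - A$1)) / w"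
      have "n$1 * (X$1 - A$1) + n$2 * (X$2 - A$2) = 0"
        using E2(2)[OF X] E2(2)[of A] by (simp add: algebra_simps)
      then have "w * (X$1 - A$1) = (n$1 * (X$2 - A$2) - n$2 * (X$1 - A$1)) * (- n$2)"
        "w * (X$2 - A$2) = (n$1 * (X$2 - A$2) - n$2 * (X$1 - A$1)) * n$1"
        unfolding w_def by algebra+
      then have "X$1 - A$1 = r * (- n$2)" "X$2 - A$2 = r * n$1"
        using w by (simp_all add: r_def field_simps)
      then have "X = (1 - r) *\<^sub>R A + r *\<^sub>R (A + v)"
        using E2(1)[OF X] E2(1)[of A] by (simp add: vec3_eq_iff v algebra_simps)
      then show ?thesis
        unfolding affine_hull_2 by (metis (mono_tags, lifting) diff_add_cancel mem_Collect_eq)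
    qed
    ultimately show ?thesis by blast
  next
    case False
    let ?P = "{x. n \<bullet> x = 0}"
    have "{A, B, C} \<subseteq> surface G \<inter> ?P"
      using n(2) surf False by (auto simp: lift_def)
    moreover from this have "is_line G (surface G \<inter> ?P)"
      using False n(1) by (auto simp: is_line_def subspace_hyperplane dim_hyperplane intro!: exI[of _ ?P])
    ultimately show ?thesis by blast
  qed
  with assms show False unfolding triangle_def by blast
qed

text \<open>
  Expanding \<open>gsin (XZ)\<close> and \<open>gsin (ZY)\<close> bilinearly gives \<open>y gsin (XY)\<close> and \<open>x gsin (XY)\<close>.
\<close>

lemma point_on_side:
  assumes l: "oriented_line G l" and on: "X \<in> range l" "Y \<in> range l" "Z \<in> range l"
    and indep: "lift G X \<times> lift G Y \<noteq> 0" and nz: "gsin_seg G l Z Y \<noteq> 0"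
  shows "\<exists>x y. x \<noteq> 0 \<and> lift G Z = x *\<^sub>R lift G X + y *\<^sub>R lift G Y \<and>
    gsin_seg G l X Z / gsin_seg G l Z Y = y / x"
proof -
  obtain m n where "n \<noteq> 0" and n: "\<And>X. X \<in> range l \<Longrightarrow> n \<bullet> lift G X = 0"
    and m: "\<And>X Y. X \<in> range l \<Longrightarrow> Y \<in> range l \<Longrightarrow> gsin_seg G l X Y = triple m (lift G X) (lift G Y)"
    using gsin_seg_eq_triple[OF l] by blast
  have "triple (lift G Z) (lift G X) (lift G Y) = 0"
    unfolding triple_eq_0_iff using \<open>n \<noteq> 0\<close> n on by blast
  then obtain x y where Z: "lift G Z = x *\<^sub>R lift G X + y *\<^sub>R lift G Y"
    using plane_coordinates[OF indep] by metis
  have "gsin_seg G l X Z = y * gsin_seg G l X Y" "gsin_seg G l Z Y = x * gsin_seg G l X Y"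
    using on by (simp_all add: m Z cross_add_left cross_add_right cross_mult_left cross_mult_right)
  with nz Z show ?thesis by (intro exI[of _ x] exI[of _ y]) auto
qed

text \<open>
  A binary quadratic form is determined up to a factor by two distinct zeros: it is
  \<open>\<kappa> (y1 x - x1 y) (y2 x - x2 y)\<close>.
\<close>

lemma binary_form_of_roots:
  fixes P U Q :: real
  assumes "P * x1\<^sup>2 + U * (x1 * y1) + Q * y1\<^sup>2 = 0" "P * x2\<^sup>2 + U * (x2 * y2) + Q * y2\<^sup>2 = 0"
    and "x1 \<noteq> 0" "x2 \<noteq> 0" "x1 * y2 \<noteq> x2 * y1"
  shows "\<exists>\<kappa>. P = \<kappa> * (y1 * y2) \<and> U = - \<kappa> * (x1 * y2 + x2 * y1) \<and> Q = \<kappa> * (x1 * x2)"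
proof -
  have "(x1 * y2 - x2 * y1) * (P * (x1 * x2) - Q * (y1 * y2)) = 0"
    "(x1 * y2 - x2 * y1) * (U * (x1 * x2) + Q * (x1 * y2 + x2 * y1)) = 0"
    using assms(1,2) by algebra+
  then have "P * (x1 * x2) = Q * (y1 * y2)" "U * (x1 * x2) = - (Q * (x1 * y2 + x2 * y1))"
    using assms(5) by simp_all
  then show ?thesis
    using assms(3,4) by (intro exI[of _ "Q / (x1 * x2)"]) (simp add: field_simps)
qed

text \<open>
  With \<open>\<kappa>, \<mu>, \<nu>\<close> the factors of the restrictions of \<open>F\<close> to the three sides, comparing the
  coefficients of the squares gives \<open>\<kappa> x1 x2 = \<mu> v1 v2\<close>, \<open>\<mu> u1 u2 = \<nu> t1 t2\<close> and
  \<open>\<nu> s1 s2 = \<kappa> y1 y2\<close>. If one factor were 0, all would be, and \<open>F\<close> with them; so the three equations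
  may be multiplied and the factors cancelled. Conversely, with \<open>\<kappa> = 1\<close>, the first and third
  equation define \<open>\<mu>\<close> and \<open>\<nu>\<close>, and the product condition is the second one.
\<close>

lemma Carnot_for_forms:
  assumes basis: "triple a b c \<noteq> 0"
    and nz: "x1 \<noteq> 0" "x2 \<noteq> 0" "u1 \<noteq> 0" "u2 \<noteq> 0" "s1 \<noteq> 0" "s2 \<noteq> 0"
    and distinct: "x1 * y2 \<noteq> x2 * y1" "u1 * v2 \<noteq> u2 * v1" "s1 * t2 \<noteq> s2 * t1"
  shows "(\<exists>F. quadratic_form F \<and> (\<exists>x. F x \<noteq> 0) \<and>
      F (x1 *\<^sub>R a + y1 *\<^sub>R b) = 0 \<and> F (x2 *\<^sub>R a + y2 *\<^sub>R b) = 0 \<and>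
      F (u1 *\<^sub>R b + v1 *\<^sub>R c) = 0 \<and> F (u2 *\<^sub>R b + v2 *\<^sub>R c) = 0 \<and>
      F (s1 *\<^sub>R c + t1 *\<^sub>R a) = 0 \<and> F (s2 *\<^sub>R c + t2 *\<^sub>R a) = 0) \<longleftrightarrow>
    (y1 * y2) * (v1 * v2) * (t1 * t2) = (x1 * x2) * (u1 * u2) * (s1 * s2)"
    (is "?lhs \<longleftrightarrow> ?rhs")
proof
  assume ?lhs
  then obtain F where F: "quadratic_form F" "\<exists>x. F x \<noteq> 0"
    and AB: "F (x1 *\<^sub>R a + y1 *\<^sub>R b) = 0" "F (x2 *\<^sub>R a + y2 *\<^sub>R b) = 0"
    and BC: "F (u1 *\<^sub>R b + v1 *\<^sub>R c) = 0" "F (u2 *\<^sub>R b + v2 *\<^sub>R c) = 0"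
    and CA: "F (s1 *\<^sub>R c + t1 *\<^sub>R a) = 0" "F (s2 *\<^sub>R c + t2 *\<^sub>R a) = 0"
    by blast
  obtain B S C U T A where coeff: "\<And>r s t. F (r *\<^sub>R a + s *\<^sub>R b + t *\<^sub>R c) =
      B * s\<^sup>2 + S * (s * t) + C * t\<^sup>2 + U * (r * s) + T * (r * t) + A * r\<^sup>2"
    using quadratic_form_combination[OF F(1), of a b c] by blast
  have "A * x1\<^sup>2 + U * (x1 * y1) + B * y1\<^sup>2 = 0" "A * x2\<^sup>2 + U * (x2 * y2) + B * y2\<^sup>2 = 0"
    using coeff[of x1 y1 0] coeff[of x2 y2 0] AB by simp_all
  then obtain \<kappa> where l: "A = \<kappa> * (y1 * y2)" "U = - \<kappa> * (x1 * y2 + x2 * y1)" "B = \<kappa> * (x1 * x2)"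
    using binary_form_of_roots nz distinct by blast
  have "B * u1\<^sup>2 + S * (u1 * v1) + C * v1\<^sup>2 = 0" "B * u2\<^sup>2 + S * (u2 * v2) + C * v2\<^sup>2 = 0"
    using coeff[of 0 u1 v1] coeff[of 0 u2 v2] BC by simp_all
  then obtain \<mu> where m: "B = \<mu> * (v1 * v2)" "S = - \<mu> * (u1 * v2 + u2 * v1)" "C = \<mu> * (u1 * u2)"
    using binary_form_of_roots nz distinct by blast
  have "C * s1\<^sup>2 + T * (s1 * t1) + A * t1\<^sup>2 = 0" "C * s2\<^sup>2 + T * (s2 * t2) + A * t2\<^sup>2 = 0"
    using coeff[of t1 0 s1] coeff[of t2 0 s2] CA by (simp_all add: add.commute add.left_commute mult.commute)
  then obtain \<nu> where n: "C = \<nu> * (t1 * t2)" "T = - \<nu> * (s1 * t2 + s2 * t1)" "A = \<nu> * (s1 * s2)"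
    using binary_form_of_roots nz distinct by blast
  have eqs: "\<kappa> * (x1 * x2) = \<mu> * (v1 * v2)" "\<mu> * (u1 * u2) = \<nu> * (t1 * t2)" "\<nu> * (s1 * s2) = \<kappa> * (y1 * y2)"
    using l m n by simp_all
  have "\<not> (\<kappa> = 0 \<and> \<mu> = 0 \<and> \<nu> = 0)"
  proof
    assume "\<kappa> = 0 \<and> \<mu> = 0 \<and> \<nu> = 0"
    then have "F (r *\<^sub>R a + s *\<^sub>R b + t *\<^sub>R c) = 0" for r s t
      by (simp add: coeff l(1,2) m n(2))
    with F(2) basis_expansion[OF basis] show False by metis
  qed
  with eqs nz have "\<kappa> \<noteq> 0" "\<mu> \<noteq> 0" "\<nu> \<noteq> 0" by auto
  moreover have "(\<kappa> * \<mu> * \<nu>) * ((x1 * x2) * (u1 * u2) * (s1 * s2))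
      = (\<kappa> * \<mu> * \<nu>) * ((y1 * y2) * (v1 * v2) * (t1 * t2))"
    using eqs by algebra
  ultimately show ?rhs by simp
next
  assume eq: ?rhs
  then have yvt: "y1 \<noteq> 0" "y2 \<noteq> 0" "v1 \<noteq> 0" "v2 \<noteq> 0" "t1 \<noteq> 0" "t2 \<noteq> 0"
    using nz by auto
  define \<mu> \<nu> where "\<mu> = (x1 * x2) / (v1 * v2)" and "\<nu> = (y1 * y2) / (s1 * s2)"
  have mv: "\<mu> * (v1 * v2) = x1 * x2" and ns: "\<nu> * (s1 * s2) = y1 * y2"
    using yvt nz by (simp_all add: \<mu>_def \<nu>_def)
  have mn: "\<mu> * (u1 * u2) = \<nu> * (t1 * t2)"
    using eq yvt nz by (simp add: \<mu>_def \<nu>_def field_simps)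
  obtain F where F: "quadratic_form F" and coeff: "\<And>r s t. F (r *\<^sub>R a + s *\<^sub>R b + t *\<^sub>R c) =
      (x1 * x2) * s\<^sup>2 + (- \<mu> * (u1 * v2 + u2 * v1)) * (s * t) + (\<mu> * (u1 * u2)) * t\<^sup>2
      + (- (x1 * y2 + x2 * y1)) * (r * s) + (- \<nu> * (s1 * t2 + s2 * t1)) * (r * t) + (y1 * y2) * r\<^sup>2"
    using quadratic_form_of_coefficients[OF basis] by blast
  have AB: "F (x *\<^sub>R a + y *\<^sub>R b) = (x * y1 - x1 * y) * (x * y2 - x2 * y)" for x y
    using coeff[of x y 0] by (simp add: algebra_simps power2_eq_square)
  have BC: "F (u *\<^sub>R b + v *\<^sub>R c) = \<mu> * ((u * v1 - u1 * v) * (u * v2 - u2 * v))" for u v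
    using coeff[of 0 u v] unfolding mv[symmetric] by (simp add: algebra_simps power2_eq_square)
  have CA: "F (s *\<^sub>R c + t *\<^sub>R a) = \<nu> * ((s * t1 - s1 * t) * (s * t2 - s2 * t))" for s t
    using coeff[of t 0 s] unfolding mn ns[symmetric]
    by (simp add: algebra_simps power2_eq_square)
  have "F b \<noteq> 0"
    using AB[of 0 1] nz by simp
  with F show ?lhs
    by (intro exI[of _ F]) (auto simp: AB BC CA)
qed

theorem theorem13:
  fixes G :: geometry
    and A B C A1 A2 B1 B2 C1 C2 :: "real^3"
    and BC AC AB :: "real \<Rightarrow> real^3"
  assumes "triangle G A B C"
    and "oriented_line G BC" and "{B, C} \<subseteq> range BC"
    and "oriented_line G AC" and "{A, C} \<subseteq> range AC"
    and "oriented_line G AB" and "{A, B} \<subseteq> range AB"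
    and "{A1, A2} \<subseteq> range BC" and "{B1, B2} \<subseteq> range AC" and "{C1, C2} \<subseteq> range AB"
    and "A1 \<noteq> A2" and "\<not> antipodal G A1 A2"
    and "B1 \<noteq> B2" and "\<not> antipodal G B1 B2"
    and "C1 \<noteq> C2" and "\<not> antipodal G C1 C2"
    and "gsin_seg G AB C1 B \<noteq> 0" and "gsin_seg G AB C2 B \<noteq> 0"
    and "gsin_seg G BC A1 C \<noteq> 0" and "gsin_seg G BC A2 C \<noteq> 0"
    and "gsin_seg G AC B1 A \<noteq> 0" and "gsin_seg G AC B2 A \<noteq> 0"
  shows "(\<exists>Q. conic G Q \<and> {A1, A2, B1, B2, C1, C2} \<subseteq> Q) \<longleftrightarrow>
    gsin_seg G AB A C1 / gsin_seg G AB C1 B * (gsin_seg G AB A C2 / gsin_seg G AB C2 B) *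
    (gsin_seg G BC B A1 / gsin_seg G BC A1 C) * (gsin_seg G BC B A2 / gsin_seg G BC A2 C) *
    (gsin_seg G AC C B1 / gsin_seg G AC B1 A) * (gsin_seg G AC C B2 / gsin_seg G AC B2 A) = 1"
proof -
  let ?a = "lift G A" and ?b = "lift G B" and ?c = "lift G C"
  have basis: "triple ?a ?b ?c \<noteq> 0"
    using assms(1) by (rule triangle_triple_nonzero)
  then have ab: "?a \<times> ?b \<noteq> 0" and bc: "?b \<times> ?c \<noteq> 0" and ca: "?c \<times> ?a \<noteq> 0"
    using triple_rotate[of ?a ?b ?c] triple_rotate[of ?b ?c ?a] by auto
  have surf: "range BC \<subseteq> surface G" "range AC \<subseteq> surface G" "range AB \<subseteq> surface G"
    using assms(2,4,6) is_line_subset_surface unfolding oriented_line_def by blast+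
  obtain x1 y1 where C1: "x1 \<noteq> 0" "lift G C1 = x1 *\<^sub>R ?a + y1 *\<^sub>R ?b"
    "gsin_seg G AB A C1 / gsin_seg G AB C1 B = y1 / x1"
    using point_on_side[OF assms(6) _ _ _ ab assms(17)] assms(7,10) by auto
  obtain x2 y2 where C2: "x2 \<noteq> 0" "lift G C2 = x2 *\<^sub>R ?a + y2 *\<^sub>R ?b"
    "gsin_seg G AB A C2 / gsin_seg G AB C2 B = y2 / x2"
    using point_on_side[OF assms(6) _ _ _ ab assms(18)] assms(7,10) by auto
  obtain u1 v1 where A1: "u1 \<noteq> 0" "lift G A1 = u1 *\<^sub>R ?b + v1 *\<^sub>R ?c"
    "gsin_seg G BC B A1 / gsin_seg G BC A1 C = v1 / u1"
    using point_on_side[OF assms(2) _ _ _ bc assms(19)] assms(3,8) by auto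
  obtain u2 v2 where A2: "u2 \<noteq> 0" "lift G A2 = u2 *\<^sub>R ?b + v2 *\<^sub>R ?c"
    "gsin_seg G BC B A2 / gsin_seg G BC A2 C = v2 / u2"
    using point_on_side[OF assms(2) _ _ _ bc assms(20)] assms(3,8) by auto
  obtain s1 t1 where B1: "s1 \<noteq> 0" "lift G B1 = s1 *\<^sub>R ?c + t1 *\<^sub>R ?a"
    "gsin_seg G AC C B1 / gsin_seg G AC B1 A = t1 / s1"
    using point_on_side[OF assms(4) _ _ _ ca assms(21)] assms(5,9) by auto
  obtain s2 t2 where B2: "s2 \<noteq> 0" "lift G B2 = s2 *\<^sub>R ?c + t2 *\<^sub>R ?a"
    "gsin_seg G AC C B2 / gsin_seg G AC B2 A = t2 / s2"
    using point_on_side[OF assms(4) _ _ _ ca assms(22)] assms(5,9) by auto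
  have cross: "(x *\<^sub>R X + y *\<^sub>R Y) \<times> (x' *\<^sub>R X + y' *\<^sub>R Y) = (x * y' - x' * y) *\<^sub>R (X \<times> Y)"
    for x y x' y' X Y
    by (simp add: cross_add_left cross_add_right cross_mult_left cross_mult_right
        cross_skew[of Y X] scaleR_diff_left mult.commute)
  have onS: "{A1, A2} \<subseteq> surface G" "{B1, B2} \<subseteq> surface G" "{C1, C2} \<subseteq> surface G"
    using order_trans[OF assms(8) surf(1)] order_trans[OF assms(9) surf(2)]
      order_trans[OF assms(10) surf(3)] by this+
  have "lift G C1 \<times> lift G C2 \<noteq> 0" "lift G A1 \<times> lift G A2 \<noteq> 0" "lift G B1 \<times> lift G B2 \<noteq> 0"
    using assms(11-16) onS by (simp_all add: lift_cross_nonzero)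
  then have distinct: "x1 * y2 \<noteq> x2 * y1" "u1 * v2 \<noteq> u2 * v1" "s1 * t2 \<noteq> s2 * t1"
    unfolding C1 C2 A1 A2 B1 B2 cross by auto
  let ?S = "{A1, A2, B1, B2, C1, C2}"
  \<comment> \<open>The points are not on one line, since the two points on a side determine that side.\<close>
  have spread: "n = 0" if n: "\<And>X. X \<in> ?S \<Longrightarrow> n \<bullet> lift G X = 0" for n
  proof -
    have kernel: "n \<bullet> X = 0 \<and> n \<bullet> Y = 0"
      if "n \<bullet> (x *\<^sub>R X + y *\<^sub>R Y) = 0" "n \<bullet> (x' *\<^sub>R X + y' *\<^sub>R Y) = 0" "x * y' \<noteq> x' * y"
      for x y x' y' X Y
    proof -
      have "(x * y' - x' * y) * (n \<bullet> X) = 0" "(x * y' - x' * y) * (n \<bullet> Y) = 0"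
        using that(1,2) unfolding inner_add_right inner_scaleR_right by algebra+
      with that(3) show ?thesis by simp
    qed
    have "n \<bullet> lift G C1 = 0" "n \<bullet> lift G C2 = 0" "n \<bullet> lift G A1 = 0" "n \<bullet> lift G A2 = 0"
      by (simp_all add: n)
    note n_sides = this[unfolded C1(2) C2(2) A1(2) A2(2)]
    have "n \<bullet> ?a = 0 \<and> n \<bullet> ?b = 0" "n \<bullet> ?b = 0 \<and> n \<bullet> ?c = 0"
      using kernel[OF n_sides(1,2) distinct(1)] kernel[OF n_sides(3,4) distinct(2)] .
    with basis show "n = 0" unfolding triple_eq_0_iff by blast
  qed
  have "(\<exists>Q. conic G Q \<and> ?S \<subseteq> Q) \<longleftrightarrow>
      (\<exists>F. quadratic_form F \<and> (\<exists>x. F x \<noteq> 0) \<and> (\<forall>X\<in>?S. F (lift G X) = 0))"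
  proof
    assume "\<exists>Q. conic G Q \<and> ?S \<subseteq> Q"
    then show "\<exists>F. quadratic_form F \<and> (\<exists>x. F x \<noteq> 0) \<and> (\<forall>X\<in>?S. F (lift G X) = 0)"
      using form_of_conic by (meson subsetD)
  next
    assume "\<exists>F. quadratic_form F \<and> (\<exists>x. F x \<noteq> 0) \<and> (\<forall>X\<in>?S. F (lift G X) = 0)"
    then obtain F x where F: "quadratic_form F" "F x \<noteq> 0" "\<forall>X\<in>?S. F (lift G X) = 0"
      by blast
    have "?S \<subseteq> surface G" using onS by simp
    with F spread show "\<exists>Q. conic G Q \<and> ?S \<subseteq> Q"
      by (intro conic_of_form[OF F(1,2)]) blast+
  qed
  also have "\<dots> \<longleftrightarrow> (\<exists>F. quadratic_form F \<and> (\<exists>x. F x \<noteq> 0) \<and>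
      F (x1 *\<^sub>R ?a + y1 *\<^sub>R ?b) = 0 \<and> F (x2 *\<^sub>R ?a + y2 *\<^sub>R ?b) = 0 \<and>
      F (u1 *\<^sub>R ?b + v1 *\<^sub>R ?c) = 0 \<and> F (u2 *\<^sub>R ?b + v2 *\<^sub>R ?c) = 0 \<and>
      F (s1 *\<^sub>R ?c + t1 *\<^sub>R ?a) = 0 \<and> F (s2 *\<^sub>R ?c + t2 *\<^sub>R ?a) = 0)"
    unfolding ball_simps C1(2)[symmetric] C2(2)[symmetric] A1(2)[symmetric] A2(2)[symmetric]
      B1(2)[symmetric] B2(2)[symmetric]
    by (intro ex_cong1) blast
  also have "\<dots> \<longleftrightarrow> (y1 * y2) * (v1 * v2) * (t1 * t2) = (x1 * x2) * (u1 * u2) * (s1 * s2)"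
    using Carnot_for_forms[OF basis C1(1) C2(1) A1(1) A2(1) B1(1) B2(1) distinct] .
  also have "\<dots> \<longleftrightarrow> y1 / x1 * (y2 / x2) * (v1 / u1) * (v2 / u2) * (t1 / s1) * (t2 / s2) = 1"
    using C1(1) C2(1) A1(1) A2(1) B1(1) B2(1) by (auto simp: field_simps)
  finally show ?thesis
    unfolding C1(3) C2(3) A1(3) A2(3) B1(3) B2(3) .
qed

end
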